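(* Let $\Pi$ be a simple root system compatible with $C$, and let $\langle\cdot,\cdot\rangle^\Pi$ be the bilinear form on the root lattice $Q(R)$ determined by $\langle\beta_i^\Pi,\alpha_j^\Pi\rangle^\Pi=\delta_{ij}$ for all $i,j\in I$. Then: (1) For all $i,j\in I$, $\langle\beta_i^\Pi,\beta_j^\Pi\rangle^\Pi=1$ if $i\leqslant j$ and $0$ otherwise; equivalently, it equals the number of oriented paths $i\to\cdots\to j$ in $(I,\Omega_\Pi)$. (2) $\langle\cdot,\cdot\rangle^\Pi$ is integer valued on $R$ and satisfies, for all $x,y$, $$\langle x,y\rangle^\Pi+\langle y,x\rangle^\Pi=(x,y),\qquad \langle x,y\rangle^\Pi=-\langle y,C^{-1}x\rangle^\Pi,$$ where $(\cdot,\cdot)$ is the $W$-invariant inner product in $E$ normalized so that $(\alpha,\alpha)=2$ for $\alpha\in R$.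
   Context: $R\subset E$ is a reduced, irreducible, simply-laced root system (type $A,D,E$) of rank $r$ in a Euclidean space $E$; $W$ is its Weyl group, $Q(R)$ its root lattice. A simple root system $\Pi\subset R$ is a base of $R$. There is a fixed index set $I$ and, for each simple root system $\Pi$, a bijection $I\to\Pi$, $i\mapsto\alpha_i^\Pi$, such that $w(\alpha_i^\Pi)=\alpha_i^{w(\Pi)}$ for all $w\in W$. For $i\ne j$ put $n_{ij}=-(\alpha_i^\Pi,\alpha_j^\Pi)\in\{0,1\}$ (independent of $\Pi$); $I$ also denotes the Dynkin diagram, the graph with vertex set $I$ and $n_{ij}$ edges between $i$ and $j$. Let $s_i^\Pi$ be the reflection in $\alpha_i^\Pi$. A Coxeter element is a product, in some order, of all the simple reflections of some simple root system, each taken once. A Coxeter element $C$ is fixed. $\Pi$ is compatible with $C$ if $C=s^\Pi_{i_1}\cdots s^\Pi_{i_r}$ for some enumeration $i_1,\dots,i_r$ of $I$. For compatible $\Pi$, the orientation $\Omega_\Pi$ of $I$ is: for $n_{ij}=1$, $i\to j$ if $s_i^\Pi$ precedes $s_j^\Pi$ in such an expression for $C$ (independent of the expression). Write $i\leqslant j$ if there is an oriented path (possibly of length $0$) from $i$ to $j$ in $\Omega_\Pi$, and set $\beta_i^\Pi=\sum_{j\leqslant i}\alpha_j^\Pi$; the $\beta_i^\Pi$ form a basis of $Q(R)$. *)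

theory Defs
  imports "HOL-Analysis.Analysis" "HOL-Computational_Algebra.Group_Closure"
begin

subsection \<open>Root systems\<close>

definition reflection :: "'a::real_inner \<Rightarrow> 'a \<Rightarrow> 'a" where
  "reflection \<alpha> x = x - (2 * (x \<bullet> \<alpha>) / (\<alpha> \<bullet> \<alpha>)) *\<^sub>R \<alpha>"

definition refl_prod :: "'a::real_inner list \<Rightarrow> 'a \<Rightarrow> 'a" where
  "refl_prod xs = foldr (\<circ>) (map reflection xs) id"

definition root_system :: "'a::euclidean_space set \<Rightarrow> bool" where
  "root_system R \<longleftrightarrow>
     finite R \<and> 0 \<notin> R \<and> span R = UNIV \<and>
     (\<forall>\<alpha>\<in>R. \<forall>\<beta>\<in>R. reflection \<alpha> \<beta> \<in> R) \<and>
     (\<forall>\<alpha>\<in>R. \<forall>\<beta>\<in>R. 2 * (\<beta> \<bullet> \<alpha>) / (\<alpha> \<bullet> \<alpha>) \<in> \<int>)"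

definition reduced_system :: "'a::euclidean_space set \<Rightarrow> bool" where
  "reduced_system R \<longleftrightarrow> (\<forall>\<alpha>\<in>R. \<forall>c. c *\<^sub>R \<alpha> \<in> R \<longrightarrow> c = 1 \<or> c = -1)"

definition irreducible_system :: "'a::euclidean_space set \<Rightarrow> bool" where
  "irreducible_system R \<longleftrightarrow>
     R \<noteq> {} \<and>
     \<not> (\<exists>R1 R2. R1 \<noteq> {} \<and> R2 \<noteq> {} \<and> R1 \<union> R2 = R \<and> (\<forall>\<alpha>\<in>R1. \<forall>\<beta>\<in>R2. \<alpha> \<bullet> \<beta> = 0))"

definition simply_laced :: "'a::euclidean_space set \<Rightarrow> bool" where
  "simply_laced R \<longleftrightarrow> (\<forall>\<alpha>\<in>R. \<forall>\<beta>\<in>R. norm \<alpha> = norm \<beta>)"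

text \<open>Reflections are involutions, so the group they generate consists of their finite products.\<close>

definition weyl_group :: "'a::euclidean_space set \<Rightarrow> ('a \<Rightarrow> 'a) set" where
  "weyl_group R = refl_prod ` lists R"

abbreviation root_lattice :: "'a::euclidean_space set \<Rightarrow> 'a set" where
  "root_lattice R \<equiv> group_closure R"

definition simple_root_system :: "'a::euclidean_space set \<Rightarrow> 'a set \<Rightarrow> bool" where
  "simple_root_system R \<Delta> \<longleftrightarrow>
     \<Delta> \<subseteq> R \<and> independent \<Delta> \<and> span \<Delta> = UNIV \<and>
     (\<forall>\<gamma>\<in>R. \<exists>c :: 'a \<Rightarrow> int. \<gamma> = (\<Sum>\<delta>\<in>\<Delta>. of_int (c \<delta>) *\<^sub>R \<delta>) \<and>
        ((\<forall>\<delta>\<in>\<Delta>. c \<delta> \<ge> 0) \<or> (\<forall>\<delta>\<in>\<Delta>. c \<delta> \<le> 0)))"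

text \<open>
  The Euclidean structure of the ambient type serves only to define the root system and its
  reflections; the form \<open>ip\<close> below is the invariant inner product rescaled so that all roots
  have square length 2. On a root system spanning the space it is unique.
\<close>

definition normalized_inner_product ::
    "'a::euclidean_space set \<Rightarrow> ('a \<Rightarrow> 'a \<Rightarrow> real) \<Rightarrow> bool" where
  "normalized_inner_product R ip \<longleftrightarrow>
     bilinear ip \<and> (\<forall>x y. ip x y = ip y x) \<and> (\<forall>x. x \<noteq> 0 \<longrightarrow> ip x x > 0) \<and>
     (\<forall>w\<in>weyl_group R. \<forall>x y. ip (w x) (w y) = ip x y) \<and>
     (\<forall>\<alpha>\<in>R. ip \<alpha> \<alpha> = 2)"

subsection \<open>Labelled simple root systems and Coxeter elements\<close>

text \<open>\<open>lab \<Delta> i\<close> is the simple root $\alpha_i^\Delta$.\<close>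

definition equivariant_labelling ::
    "'a::euclidean_space set \<Rightarrow> 'i set \<Rightarrow> ('a set \<Rightarrow> 'i \<Rightarrow> 'a) \<Rightarrow> bool" where
  "equivariant_labelling R I lab \<longleftrightarrow>
     (\<forall>\<Delta>. simple_root_system R \<Delta> \<longrightarrow> bij_betw (lab \<Delta>) I \<Delta>) \<and>
     (\<forall>\<Delta>. simple_root_system R \<Delta> \<longrightarrow>
        (\<forall>w\<in>weyl_group R. \<forall>i\<in>I. w (lab \<Delta> i) = lab (w ` \<Delta>) i))"

definition enumerates :: "'b list \<Rightarrow> 'b set \<Rightarrow> bool" where
  "enumerates xs A \<longleftrightarrow> distinct xs \<and> set xs = A"

definition coxeter_element :: "'a::euclidean_space set \<Rightarrow> ('a \<Rightarrow> 'a) \<Rightarrow> bool" where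
  "coxeter_element R C \<longleftrightarrow>
     (\<exists>\<Delta> xs. simple_root_system R \<Delta> \<and> enumerates xs \<Delta> \<and> C = refl_prod xs)"

definition coxeter_expression ::
    "'i set \<Rightarrow> ('a set \<Rightarrow> 'i \<Rightarrow> 'a::euclidean_space) \<Rightarrow> ('a \<Rightarrow> 'a) \<Rightarrow> 'a set \<Rightarrow> 'i list \<Rightarrow> bool" where
  "coxeter_expression I lab C \<Delta> xs \<longleftrightarrow> enumerates xs I \<and> C = refl_prod (map (lab \<Delta>) xs)"

definition coxeter_compatible ::
    "'i set \<Rightarrow> ('a set \<Rightarrow> 'i \<Rightarrow> 'a::euclidean_space) \<Rightarrow> ('a \<Rightarrow> 'a) \<Rightarrow> 'a set \<Rightarrow> bool" where
  "coxeter_compatible I lab C \<Delta> \<longleftrightarrow> (\<exists>xs. coxeter_expression I lab C \<Delta> xs)"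

definition precedes :: "'b list \<Rightarrow> 'b \<Rightarrow> 'b \<Rightarrow> bool" where
  "precedes xs i j \<longleftrightarrow> (\<exists>a b. a < b \<and> b < length xs \<and> xs ! a = i \<and> xs ! b = j)"

text \<open>The arrows $i \to j$ of $\Omega_\Delta$; the condition on \<open>ip\<close> says $n_{ij} = 1$.\<close>

definition coxeter_orientation ::
    "'i set \<Rightarrow> ('a set \<Rightarrow> 'i \<Rightarrow> 'a::euclidean_space) \<Rightarrow> ('a \<Rightarrow> 'a \<Rightarrow> real) \<Rightarrow> ('a \<Rightarrow> 'a) \<Rightarrow> 'a set \<Rightarrow> 'i rel" where
  "coxeter_orientation I lab ip C \<Delta> =
     {(i, j). i \<in> I \<and> j \<in> I \<and> i \<noteq> j \<and> - ip (lab \<Delta> i) (lab \<Delta> j) = 1 \<and>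
        (\<exists>xs. coxeter_expression I lab C \<Delta> xs \<and> precedes xs i j)}"

text \<open>Paths are given by their nonempty lists of vertices, since there are no multiple arrows.\<close>

definition oriented_paths :: "'i rel \<Rightarrow> 'i \<Rightarrow> 'i \<Rightarrow> 'i list set" where
  "oriented_paths \<Omega> i j =
     {p. p \<noteq> [] \<and> hd p = i \<and> last p = j \<and> successively (\<lambda>a b. (a, b) \<in> \<Omega>) p}"

definition path_le :: "'i rel \<Rightarrow> 'i \<Rightarrow> 'i \<Rightarrow> bool" where
  "path_le \<Omega> i j \<longleftrightarrow> oriented_paths \<Omega> i j \<noteq> {}"

definition \<beta>_root ::
    "'i set \<Rightarrow> ('a set \<Rightarrow> 'i \<Rightarrow> 'a::euclidean_space) \<Rightarrow> ('a \<Rightarrow> 'a \<Rightarrow> real) \<Rightarrow> ('a \<Rightarrow> 'a) \<Rightarrow> 'a set \<Rightarrow> 'i \<Rightarrow> 'a" where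
  "\<beta>_root I lab ip C \<Delta> i = (\<Sum>j | j \<in> I \<and> path_le (coxeter_orientation I lab ip C \<Delta>) j i. lab \<Delta> j)"

subsection \<open>The bilinear form\<close>

text \<open>Bilinearity over the integers is additivity in each argument.\<close>

definition lattice_bilinear :: "'a::ab_group_add set \<Rightarrow> ('a \<Rightarrow> 'a \<Rightarrow> real) \<Rightarrow> bool" where
  "lattice_bilinear L B \<longleftrightarrow>
     (\<forall>x\<in>L. \<forall>y\<in>L. \<forall>z\<in>L. B (x + y) z = B x z + B y z \<and> B z (x + y) = B z x + B z y)"

definition is_coxeter_form ::
    "'a set \<Rightarrow> 'i set \<Rightarrow> ('a set \<Rightarrow> 'i \<Rightarrow> 'a::euclidean_space) \<Rightarrow> ('a \<Rightarrow> 'a \<Rightarrow> real) \<Rightarrow> ('a \<Rightarrow> 'a) \<Rightarrow> 'a set \<Rightarrow>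
     ('a \<Rightarrow> 'a \<Rightarrow> real) \<Rightarrow> bool" where
  "is_coxeter_form R I lab ip C \<Delta> B \<longleftrightarrow>
     lattice_bilinear (root_lattice R) B \<and>
     (\<forall>i\<in>I. \<forall>j\<in>I. B (\<beta>_root I lab ip C \<Delta> i) (lab \<Delta> j) = (if i = j then 1 else 0))"

end

(*
  Put E y x = (C w, y), where w is the solution of C w - w = x. The telescoping sum for C w - w along
  any expression of C as an ordered product of simple reflections shows that E (a k) (a l) is 1 for
  k = l, is (a l, a k) if l precedes k, and is 0 otherwise. As E depends only on C, this makes the
  orientation independent of the expression; it also gives E x y + E y x = (x, y), and the definition
  of E says E y (x - C^-1 x) = (x, y). Positivity of E forbids cycles in the Dynkin diagram, so
  oriented paths are unique, and then the beta_i are dual to the simple roots with respect to E.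
*)

theory Submission
  imports Defs
begin

section \<open>Reflections and their ordered products\<close>

lemma refl_prod_Nil [simp]: "refl_prod [] = id"
  by (simp add: refl_prod_def)

lemma refl_prod_Cons [simp]: "refl_prod (x # xs) = reflection x \<circ> refl_prod xs"
  by (simp add: refl_prod_def)

lemma refl_prod_snoc: "refl_prod (xs @ [x]) = refl_prod xs \<circ> reflection x"
  by (induction xs) (auto simp: o_assoc)

lemma linear_reflection: "linear (reflection \<alpha>)"
  by (rule linearI)
    (simp_all add: reflection_def inner_add_left algebra_simps add_divide_distrib)

lemma reflection_reflection [simp]: "reflection \<alpha> (reflection \<alpha> x) = x"
  by (cases "\<alpha> = 0") (simp_all add: reflection_def inner_diff_left)

lemma linear_refl_prod: "linear (refl_prod xs)"
  by (induction xs) (simp_all only: refl_prod_Nil refl_prod_Cons linear_id linear_compose linear_reflection)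

lemma bij_reflection: "bij (reflection \<alpha>)"
  by (rule o_bij[of "reflection \<alpha>"]) auto

lemma bij_refl_prod: "bij (refl_prod xs)"
  by (induction xs) (simp_all only: refl_prod_Nil refl_prod_Cons bij_id bij_comp bij_reflection)

lemma inv_refl_prod: "inv (refl_prod xs) = refl_prod (rev xs)"
proof (induction xs)
  case (Cons x xs)
  have "inv (reflection x) = reflection x"
    by (rule inv_unique_comp) auto
  with Cons show ?case
    by (simp only: refl_prod_Cons rev.simps refl_prod_snoc o_inv_distrib bij_reflection bij_refl_prod)
qed simp

section \<open>Order of occurrence in a list\<close>

lemma precedes_in_set: "precedes xs i j \<Longrightarrow> i \<in> set xs \<and> j \<in> set xs"
  by (auto simp: precedes_def)

lemma precedes_irrefl: "distinct xs \<Longrightarrow> \<not> precedes xs i i"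
  by (auto simp: precedes_def nth_eq_iff_index_eq)

lemma precedes_trans: "distinct xs \<Longrightarrow> precedes xs i j \<Longrightarrow> precedes xs j k \<Longrightarrow> precedes xs i k"
  unfolding precedes_def by (metis nth_eq_iff_index_eq order.strict_trans)

lemma precedes_total:
  assumes "i \<in> set xs" "j \<in> set xs" "i \<noteq> j"
  shows "precedes xs i j \<or> precedes xs j i"
proof -
  obtain m n where "m < length xs" "xs ! m = i" "n < length xs" "xs ! n = j"
    using assms by (metis in_set_conv_nth)
  then show ?thesis
    using assms(3) unfolding precedes_def by (metis linorder_neqE_nat)
qed

lemma precedes_snoc: "precedes (xs @ [x]) i j \<longleftrightarrow> precedes xs i j \<or> i \<in> set xs \<and> j = x"
proof
  assume "precedes (xs @ [x]) i j"
  then show "precedes xs i j \<or> i \<in> set xs \<and> j = x"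
    by (auto simp: precedes_def nth_append less_Suc_eq split: if_splits)
next
  assume "precedes xs i j \<or> i \<in> set xs \<and> j = x"
  then show "precedes (xs @ [x]) i j"
  proof
    assume "precedes xs i j"
    then obtain m n where "m < n" "n < length xs" "xs ! m = i" "xs ! n = j"
      by (auto simp: precedes_def)
    then show ?thesis
      unfolding precedes_def by (intro exI[of _ m] exI[of _ n]) (auto simp: nth_append)
  next
    assume "i \<in> set xs \<and> j = x"
    then obtain m where "m < length xs" "xs ! m = i" "j = x"
      by (auto simp: in_set_conv_nth)
    then show ?thesis
      unfolding precedes_def by (intro exI[of _ m] exI[of _ "length xs"]) (auto simp: nth_append)
  qed
qed

section \<open>Bilinear forms and indexed bases\<close>

lemma bilinear_sum_left: "bilinear h \<Longrightarrow> h (sum f S) y = (\<Sum>i\<in>S. h (f i) y)"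
  using linear_sum[of "\<lambda>x. h x y" f S] by (simp add: bilinear_def)

lemma bilinear_sum_right: "bilinear h \<Longrightarrow> h x (sum f S) = (\<Sum>i\<in>S. h x (f i))"
  using linear_sum[of "h x" f S] by (simp add: bilinear_def)

text \<open>Indexing by \<open>I\<close> lets words, arrows and coefficient functions share one
  index type. The unlabelled case, needed for the roots of \<Delta>, is recovered with
  \<open>a\<close> the identity.\<close>

locale indexed_basis =
  fixes I :: "'i set" and a :: "'i \<Rightarrow> 'a::euclidean_space"
  assumes finite_index: "finite I"
    and inj: "inj_on a I"
    and indep: "independent (a ` I)"
    and span: "span (a ` I) = UNIV"
begin

lemma sum_zero_coeff:
  assumes "(\<Sum>i\<in>I. c i *\<^sub>R a i) = 0" "i \<in> I"
  shows "c i = 0"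
proof -
  have "(\<Sum>v\<in>a ` I. c (inv_into I a v) *\<^sub>R v) = (\<Sum>i\<in>I. c i *\<^sub>R a i)"
    using inj by (simp add: sum.reindex)
  with assms have "c (inv_into I a (a i)) = 0"
    using independentD[OF indep, of "a ` I" "\<lambda>v. c (inv_into I a v)" "a i"] finite_index by auto
  then show ?thesis
    using inj assms(2) by simp
qed

lemma sum_coeff_unique:
  assumes "(\<Sum>i\<in>I. c i *\<^sub>R a i) = (\<Sum>i\<in>I. d i *\<^sub>R a i)" "i \<in> I"
  shows "c i = d i"
  using sum_zero_coeff[of "\<lambda>i. c i - d i"] assms by (simp add: scaleR_left_diff_distrib sum_subtractf)

lemma bilinear_eq_on_basis:
  fixes f g :: "'a \<Rightarrow> 'a \<Rightarrow> real"
  assumes "bilinear f" "bilinear g" "\<And>i j. i \<in> I \<Longrightarrow> j \<in> I \<Longrightarrow> f (a i) (a j) = g (a i) (a j)"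
  shows "f x y = g x y"
  by (rule bilinear_eq[OF assms(1,2), of UNIV "a ` I" UNIV "a ` I"]) (use span assms(3) in auto)

end

section \<open>The form defined by a Coxeter word\<close>

locale simple_root_basis = indexed_basis I a
  for I :: "'i set" and a :: "'i \<Rightarrow> 'a::euclidean_space" +
  fixes ip :: "'a \<Rightarrow> 'a \<Rightarrow> real"
  assumes bilinear_ip: "bilinear ip"
    and ip_sym: "ip x y = ip y x"
    and ip_pos: "x \<noteq> 0 \<Longrightarrow> ip x x > 0"
    and ip_self: "i \<in> I \<Longrightarrow> ip (a i) (a i) = 2"
    and reflection_ip: "i \<in> I \<Longrightarrow> reflection (a i) x = x - ip x (a i) *\<^sub>R a i"
begin

text \<open>
  The differences between the successive images of \<open>w\<close> under the factors of \<open>C\<close> add up to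
  \<open>C w - w\<close>.
\<close>

lemma refl_prod_telescope:
  assumes "distinct xs" "set xs \<subseteq> I"
  shows "\<exists>c. refl_prod (map a xs) w - w = (\<Sum>l\<in>set xs. c l *\<^sub>R a l) \<and>
    (\<forall>k\<in>set xs. ip (refl_prod (map a xs) w) (a k) =
       c k + (\<Sum>l | l \<in> set xs \<and> precedes xs l k. c l * ip (a l) (a k)))"
  using assms
\<comment> \<open>The last letter acts on \<open>w\<close> first. Peeling it off leaves the shorter
  word acting on the reflected vector, so \<open>w\<close> has to vary.\<close>
proof (induction xs arbitrary: w rule: rev_induct)
  case Nil
  then show ?case by simp
next
  case (snoc x xs)
  define w' where "w' = reflection (a x) w"
  define z where "z = refl_prod (map a xs) w'"
  have x: "x \<in> I" "x \<notin> set xs" using snoc.prems by auto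
  obtain c where c: "z - w' = (\<Sum>l\<in>set xs. c l *\<^sub>R a l)"
    and ck: "\<And>k. k \<in> set xs \<Longrightarrow> ip z (a k) =
      c k + (\<Sum>l | l \<in> set xs \<and> precedes xs l k. c l * ip (a l) (a k))"
    using snoc.IH[of w'] snoc.prems unfolding z_def by auto
  \<comment> \<open>The reflection in \<open>a x\<close> adds \<open>- ip w (a x)\<close> times
    \<open>a x\<close> to \<open>w\<close>; the other coefficients come from the shorter
    word.\<close>
  define d where "d = c(x := - ip w (a x))"
  have z_eq: "refl_prod (map a (xs @ [x])) w = z"
    by (simp add: refl_prod_snoc z_def w'_def)
  have w': "w' = w - ip w (a x) *\<^sub>R a x"
    unfolding w'_def by (rule reflection_ip[OF x(1)])
  have dc: "(\<Sum>l\<in>A. d l *\<^sub>R a l) = (\<Sum>l\<in>A. c l *\<^sub>R a l)"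
    "(\<Sum>l\<in>A. d l * f l) = (\<Sum>l\<in>A. c l * f l)" if "A \<subseteq> set xs" for A f
    using that x(2) by (auto intro!: sum.cong simp: d_def)
  have "z - w = (\<Sum>l\<in>set (xs @ [x]). d l *\<^sub>R a l)"
    using c w' x(2) dc(1)[of "set xs"] by (simp add: d_def algebra_simps)
  moreover have "ip z (a k) =
      d k + (\<Sum>l | l \<in> set (xs @ [x]) \<and> precedes (xs @ [x]) l k. d l * ip (a l) (a k))"
    if "k \<in> set (xs @ [x])" for k
  proof (cases "k = x")
    \<comment> \<open>Every other letter precedes \<open>x\<close>, so the sum accounts for all of
      \<open>z - w'\<close>. What remains is \<open>ip w' (a x)\<close>, and this is
      \<open>d x\<close> because the reflection negates the pairing with \<open>a x\<close>.\<close>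
    case True
    have set_eq: "{l. l \<in> set (xs @ [x]) \<and> precedes (xs @ [x]) l x} = set xs"
      using x(2) by (auto simp: precedes_snoc dest: precedes_in_set)
    have "ip w' (a x) = - ip w (a x)"
      unfolding w' by (simp add: bilinear_lsub[OF bilinear_ip] bilinear_lmul[OF bilinear_ip] ip_self[OF x(1)])
    moreover have "ip z (a x) = ip w' (a x) + (\<Sum>l\<in>set xs. c l * ip (a l) (a x))"
    proof -
      have "ip z (a x) = ip (w' + (\<Sum>l\<in>set xs. c l *\<^sub>R a l)) (a x)"
        using c by (simp add: algebra_simps)
      then show ?thesis
        by (simp add: bilinear_ladd[OF bilinear_ip] bilinear_sum_left[OF bilinear_ip]
            bilinear_lmul[OF bilinear_ip])
    qed
    ultimately show ?thesis
      using dc(2)[of "set xs"] unfolding True set_eq by (simp add: d_def)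
  next
    \<comment> \<open>The appended letter precedes nothing, so the identity at \<open>k\<close> is
      that of the shorter word.\<close>
    case False
    then have k: "k \<in> set xs" using that by auto
    have set_eq: "{l. l \<in> set (xs @ [x]) \<and> precedes (xs @ [x]) l k} = {l. l \<in> set xs \<and> precedes xs l k}"
      using False by (auto simp: precedes_snoc dest: precedes_in_set)
    show ?thesis
      unfolding set_eq using ck[OF k] dc(2)[of "{l. l \<in> set xs \<and> precedes xs l k}"] False
      by (simp add: d_def)
  qed
  ultimately show ?case
    unfolding z_eq by blast
qed

text \<open>
  \<open>E\<close> depends on \<open>C\<close> only, so its values on the basis do not depend on the expression \<open>ys\<close>.
\<close>

lemma euler_form_exists:
  assumes xs: "enumerates xs I" and C: "C = refl_prod (map a xs)"
  obtains E where "bilinear E"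
    and "\<And>x y. E x y + E y x = ip x y"
    and "\<And>x y. E x y = - E y (inv C x)"
    and "\<And>ys k l. enumerates ys I \<Longrightarrow> C = refl_prod (map a ys) \<Longrightarrow> k \<in> I \<Longrightarrow> l \<in> I \<Longrightarrow>
      E (a k) (a l) = (if k = l then 1 else if precedes ys l k then ip (a l) (a k) else 0)"
proof -
  have linear_C: "linear C" and bij_C: "bij C"
    unfolding C by (rule linear_refl_prod, rule bij_refl_prod)
  define N where "N w = C w - w" for w
  have linear_N: "linear N"
    unfolding N_def using linear_C by (intro linear_compose_sub linear_ident) auto
  have tele: "\<exists>c. N w = (\<Sum>l\<in>I. c l *\<^sub>R a l) \<and> (\<forall>k\<in>I. ip (C w) (a k) =
      c k + (\<Sum>l | l \<in> I \<and> precedes ys l k. c l * ip (a l) (a k)))"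
    if "enumerates ys I" "C = refl_prod (map a ys)" for ys w
    using refl_prod_telescope[of ys w] that by (auto simp: enumerates_def N_def)
  \<comment> \<open>When the telescoping coefficients vanish, so do all pairings of
    \<open>C w\<close> with the basis. Hence \<open>C w = 0\<close>, and
    \<open>w = C w\<close>.\<close>
  have "w = 0" if "N w = 0" for w
  proof -
    obtain c where c: "N w = (\<Sum>l\<in>I. c l *\<^sub>R a l)" and ck: "\<And>k. k \<in> I \<Longrightarrow> ip (C w) (a k) =
      c k + (\<Sum>l | l \<in> I \<and> precedes xs l k. c l * ip (a l) (a k))"
      using tele[OF xs C] by blast
    have c0: "c k = 0" if "k \<in> I" for k
      using sum_zero_coeff[of c k] c \<open>N w = 0\<close> that by simp
    have "ip (C w) (a k) = 0" if "k \<in> I" for k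
      using ck[OF that] c0 that by simp
    moreover have "linear (ip (C w))"
      using bilinear_ip by (simp add: bilinear_def)
    ultimately have "ip (C w) y = 0" for y
      using linear_eq_0_on_span[of "ip (C w)" "a ` I" y] span by auto
    then have "C w = 0"
      using ip_pos[of "C w"] by force
    with \<open>N w = 0\<close> show ?thesis by (simp add: N_def)
  qed
  then have "inj N"
    using linear_injective_0[OF linear_N] by blast
  then obtain G where G: "linear G" "\<And>x. G (N x) = x" "\<And>x. N (G x) = x"
    using linear_injective_isomorphism[OF linear_N] by blast
  define E where "E y x = ip (C (G x)) y" for y x
  have bilinear_E: "bilinear E"
    unfolding bilinear_def
  proof (intro conjI allI)
    fix x y
    show "linear (\<lambda>x. E x y)"
      unfolding E_def using bilinear_ip by (simp add: bilinear_def)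
    have "linear (\<lambda>x. ip x y)"
      using bilinear_ip by (simp add: bilinear_def)
    from linear_compose[OF linear_compose[OF G(1) linear_C] this]
    show "linear (\<lambda>x. E y x)"
      unfolding E_def by (simp add: o_def)
  qed
  have val: "E (a k) (a l) = (if k = l then 1 else if precedes ys l k then ip (a l) (a k) else 0)"
    if ys: "enumerates ys I" "C = refl_prod (map a ys)" and kl: "k \<in> I" "l \<in> I" for ys k l
  proof -
    \<comment> \<open>\<open>C\<close> displaces the vector \<open>G (a l)\<close> by exactly
      \<open>a l\<close>, so by independence its telescoping coefficients are Kronecker
      deltas.\<close>
    obtain c where c: "a l = (\<Sum>m\<in>I. c m *\<^sub>R a m)" and ck: "E (a k) (a l) =
      c k + (\<Sum>m | m \<in> I \<and> precedes ys m k. c m * ip (a m) (a k))"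
      using tele[OF ys, of "G (a l)"] kl unfolding E_def G(3) by blast
    have "(\<Sum>m\<in>I. (if m = l then 1 else 0) *\<^sub>R a m) = a l"
      using finite_index kl(2) by (simp add: if_distrib[of "\<lambda>t. t *\<^sub>R _"] cong: if_cong)
    then have cm: "c m = (if m = l then 1 else 0)" if "m \<in> I" for m
      by (intro sum_coeff_unique that) (rule c[symmetric, THEN trans], simp)
    have "(\<Sum>m | m \<in> I \<and> precedes ys m k. c m * ip (a m) (a k)) =
      (\<Sum>m | m \<in> I \<and> precedes ys m k. if m = l then ip (a m) (a k) else 0)"
      using cm by (intro sum.cong) auto
    also have "\<dots> = (if precedes ys l k then ip (a l) (a k) else 0)"
      using finite_index kl(2) by (simp add: sum.delta')
    finally show ?thesis
      using ck cm[OF kl(1)] precedes_irrefl[of ys k] ys(1) by (auto simp: enumerates_def)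
  qed
  have symm: "E x y + E y x = ip x y" for x y
  proof (rule bilinear_eq_on_basis[of "\<lambda>x y. E x y + E y x" ip])
    show "bilinear (\<lambda>x y. E x y + E y x)"
      using bilinear_E unfolding bilinear_def by (auto intro: linear_compose_add)
    fix i j assume ij: "i \<in> I" "j \<in> I"
    \<comment> \<open>Exactly one order occurs in \<open>xs\<close>, so one of the two values of
      \<open>E\<close> is \<open>ip (a i) (a j)\<close> and the other is 0. On the diagonal 1 + 1 =
      2.\<close>
    have "precedes xs i j \<noteq> precedes xs j i" if "i \<noteq> j"
      using precedes_total[of i xs j] precedes_trans[of xs i j i] precedes_irrefl[of xs i] xs ij that
      by (auto simp: enumerates_def)
    then show "E (a i) (a j) + E (a j) (a i) = ip (a i) (a j)"
      using val[OF xs C] ij ip_self ip_sym by auto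
  qed (rule bilinear_ip)
  have inv_eq: "E x y = - E y (inv C x)" for x y
  proof -
    \<comment> \<open>\<open>C\<close> displaces \<open>inv C x\<close> by
      \<open>x - inv C x\<close>, so \<open>G\<close> sends this difference back to
      \<open>inv C x\<close> and \<open>E\<close> can be evaluated on it.\<close>
    have "C (inv C x) = x"
      using bij_C by (simp add: bij_is_surj surj_f_inv_f)
    then have "E y (x - inv C x) = ip x y"
      using G(2)[of "inv C x"] by (simp add: E_def N_def)
    then show ?thesis
      using symm[of x y] by (simp add: bilinear_rsub[OF bilinear_E])
  qed
  show ?thesis
    by (rule that[OF bilinear_E symm inv_eq val])
qed

end

section \<open>Oriented paths, and forms attached to an acyclic orientation\<close>

lemma path_le_iff_rtrancl: "path_le \<Omega> i j \<longleftrightarrow> (i, j) \<in> \<Omega>\<^sup>*"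
proof
  assume "path_le \<Omega> i j"
  then obtain p where "p \<noteq> []" "hd p = i" "last p = j" "successively (\<lambda>a b. (a, b) \<in> \<Omega>) p"
    by (auto simp: path_le_def oriented_paths_def)
  then show "(i, j) \<in> \<Omega>\<^sup>*"
    by (induction p arbitrary: i)
      (auto simp: successively_Cons intro: converse_rtrancl_into_rtrancl split: if_splits)
next
  assume "(i, j) \<in> \<Omega>\<^sup>*"
  then show "path_le \<Omega> i j"
  proof (induction rule: converse_rtrancl_induct)
    case base
    have "[j] \<in> oriented_paths \<Omega> j j" by (simp add: oriented_paths_def)
    then show ?case unfolding path_le_def by blast
  next
    case (step i k)
    then obtain p where "p \<in> oriented_paths \<Omega> k j" unfolding path_le_def by blast
    then have "i # p \<in> oriented_paths \<Omega> i j"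
      using step by (auto simp: oriented_paths_def successively_Cons)
    then show ?case unfolding path_le_def by blast
  qed
qed

lemma oriented_paths_Cons: "(i, k) \<in> \<Omega> \<Longrightarrow> p \<in> oriented_paths \<Omega> k j \<Longrightarrow> i # p \<in> oriented_paths \<Omega> i j"
  by (auto simp: oriented_paths_def successively_Cons)

text \<open>An arrow from \<open>j\<close> to \<open>i\<close> contributes to
  \<open>E (a i) (a j)\<close> only, so \<open>E\<close> is not symmetric in general. Definiteness
  stands in for the diagram having no cycles.\<close>

locale oriented_form = indexed_basis I a
  for I :: "'i set" and a :: "'i \<Rightarrow> 'a::euclidean_space" +
  fixes \<Omega> :: "'i rel" and E :: "'a \<Rightarrow> 'a \<Rightarrow> real"
  assumes bilinear_E: "bilinear E"
    and E_pos: "x \<noteq> 0 \<Longrightarrow> E x x > 0"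
    and E_basis: "i \<in> I \<Longrightarrow> j \<in> I \<Longrightarrow>
      E (a i) (a j) = (if i = j then 1 else if (j, i) \<in> \<Omega> then -1 else 0)"
    and edges_in: "\<Omega> \<subseteq> I \<times> I"
    and acyclic: "acyclic \<Omega>"
begin

lemma no_loop: "(i, k) \<in> \<Omega> \<Longrightarrow> (k, i) \<notin> \<Omega>\<^sup>*"
  using acyclic unfolding acyclic_def by (meson rtrancl_into_trancl2)

lemma reach_in: "(i, j) \<in> \<Omega>\<^sup>* \<Longrightarrow> i \<in> I \<longleftrightarrow> j \<in> I"
  by (induction rule: rtrancl_induct) (use edges_in in auto)

text \<open>
  With \<open>x\<close> the sum of the simple roots reachable from \<open>i\<close>, \<open>E x x\<close> is the number of vertices
  minus the number of edges of the subgraph they span. Each of them except \<open>i\<close> has an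
  incoming edge in it, so a second one would give \<open>E x x \<le> 0\<close>.
\<close>

lemma unique_in_edge:
  assumes i: "i \<in> I" and u: "(u, v) \<in> \<Omega>" "(i, u) \<in> \<Omega>\<^sup>*" and u': "(u', v) \<in> \<Omega>" "(i, u') \<in> \<Omega>\<^sup>*"
  shows "u = u'"
proof (rule ccontr)
  assume neq: "u \<noteq> u'"
  define S where "S = {v \<in> I. (i, v) \<in> \<Omega>\<^sup>*}"
  define In where "In v = {u \<in> S. (u, v) \<in> \<Omega>}" for v
  define x where "x = sum a S"
  have S: "finite S" "S \<subseteq> I" "i \<in> S"
    using finite_index i by (auto simp: S_def)
  have fin: "finite (In w)" for w
    using S by (simp add: In_def)
  have uS: "u \<in> S" "u' \<in> S" "v \<in> S"
    using u u' reach_in i edges_in by (auto simp: S_def intro: rtrancl_into_rtrancl)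
  \<comment> \<open>Without loops the two indicators in \<open>val\<close> never overlap.\<close>
  have "(v, v) \<notin> \<Omega>" for v
    using no_loop by blast
  then have val: "E (a w) (a t) = (if w = t then 1 else 0) - (if t \<in> In w then 1 else 0)"
    if "w \<in> S" "t \<in> S" for w t
    using E_basis[of w t] that subsetD[OF S(2)] by (auto simp: In_def)
  have row: "(\<Sum>t\<in>S. E (a w) (a t)) = 1 - real (card (In w))" if "w \<in> S" for w
  proof -
    have "(\<Sum>t\<in>S. E (a w) (a t)) =
        (\<Sum>t\<in>S. (if w = t then 1 else 0) - (if t \<in> In w then 1 else 0))"
      using val that by (intro sum.cong) auto
    also have "\<dots> = 1 - (\<Sum>t\<in>S. if t \<in> In w then 1 else 0)"
      using S that by (simp add: sum_subtractf)
    also have "(\<Sum>t\<in>S. if t \<in> In w then 1 else (0::real)) = real (card (S \<inter> In w))"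
      using S by (simp add: sum.inter_restrict[symmetric])
    also have "S \<inter> In w = In w" by (auto simp: In_def)
    finally show ?thesis .
  qed
  \<comment> \<open>The right side sums to 0 over \<open>S\<close>: the start \<open>i\<close> may
    have no incoming arrow, while \<open>v\<close> has at least two. Any other vertex is entered by
    the last arrow of a path from \<open>i\<close>.\<close>
  have bound: "1 - real (card (In w)) \<le> (if w = i then 1 else 0) - (if w = v then 1 else 0)"
    if "w \<in> S" for w
  proof -
    have "v \<noteq> i" using no_loop u by blast
    have "card (In w) \<ge> 1" if "w \<noteq> i"
    proof -
      have "(i, w) \<in> \<Omega>\<^sup>*" using \<open>w \<in> S\<close> by (simp add: S_def)
      then obtain t where "(i, t) \<in> \<Omega>\<^sup>*" "(t, w) \<in> \<Omega>"
        using \<open>w \<noteq> i\<close> by (cases rule: rtranclE) auto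
      then have "t \<in> In w"
        using edges_in by (auto simp: In_def S_def)
      then show ?thesis
        using fin[of w] by (metis One_nat_def Suc_leI card_gt_0_iff empty_iff)
    qed
    moreover have "card (In w) \<ge> 2" if "w = v"
    proof -
      have "{u, u'} \<subseteq> In w" using uS u u' that by (auto simp: In_def)
      then show ?thesis using card_mono[OF fin[of w], of "{u, u'}"] neq by simp
    qed
    ultimately show ?thesis
      using \<open>v \<noteq> i\<close> by auto
  qed
  have "E x x = (\<Sum>w\<in>S. \<Sum>t\<in>S. E (a w) (a t))"
    unfolding x_def bilinear_sum_left[OF bilinear_E, of a S "sum a S"]
    by (intro sum.cong refl bilinear_sum_right[OF bilinear_E])
  also have "\<dots> = (\<Sum>w\<in>S. 1 - real (card (In w)))"
    using row by simp
  also have "\<dots> \<le> (\<Sum>w\<in>S. (if w = i then 1 else 0) - (if w = v then 1 else 0))"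
    by (rule sum_mono) (rule bound)
  also have "\<dots> = 0"
    using S uS by (simp add: sum_subtractf)
  finally have "E x x \<le> 0" .
  \<comment> \<open>The coefficient of \<open>a i\<close> in \<open>x\<close> is 1, so independence
    excludes \<open>x = 0\<close>.\<close>
  have "x = (\<Sum>t\<in>I. (if t \<in> S then 1 else 0) *\<^sub>R a t)"
  proof -
    have "x = (\<Sum>t\<in>I \<inter> S. a t)" using S(2) by (simp add: x_def Int_absorb1)
    also have "\<dots> = (\<Sum>t\<in>I. if t \<in> S then a t else 0)"
      using finite_index by (rule sum.inter_restrict)
    also have "\<dots> = (\<Sum>t\<in>I. (if t \<in> S then 1 else 0) *\<^sub>R a t)"
      by (intro sum.cong) auto
    finally show ?thesis .
  qed
  then have "x \<noteq> 0"
    using sum_zero_coeff[of "\<lambda>t. if t \<in> S then 1 else 0" i] i S(3) by auto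
  with E_pos[of x] \<open>E x x \<le> 0\<close> show False by simp
qed

text \<open>Compared from the end, both paths enter \<open>j\<close> from vertices reachable from
  \<open>i\<close>. By \<open>unique_in_edge\<close> these vertices agree, and induction handles
  what precedes. Acyclicity excludes a trivial path beside a longer one.\<close>

lemma oriented_path_unique:
  assumes "i \<in> I" "p \<in> oriented_paths \<Omega> i j" "q \<in> oriented_paths \<Omega> i j"
  shows "p = q"
  using assms(2,3)
proof (induction p arbitrary: q j rule: rev_induct)
  case Nil
  then show ?case by (simp add: oriented_paths_def)
next
  case (snoc x p)
  \<comment> \<open>Separates the trivial path from one with a last arrow, whose tail is then
    reachable from \<open>i\<close>, as \<open>unique_in_edge\<close> requires.\<close>
  have split: "r = [] \<and> i = j \<or>
      r \<noteq> [] \<and> r \<in> oriented_paths \<Omega> i (last r) \<and> (last r, j) \<in> \<Omega> \<and> (i, last r) \<in> \<Omega>\<^sup>*"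
    if "r @ [j] \<in> oriented_paths \<Omega> i j" for r
  proof (cases "r = []")
    case False
    then have "r \<in> oriented_paths \<Omega> i (last r)" "(last r, j) \<in> \<Omega>"
      using that by (auto simp: oriented_paths_def successively_append_iff)
    then show ?thesis
      using False path_le_iff_rtrancl[of \<Omega> i "last r"] by (auto simp: path_le_def)
  qed (use that in \<open>auto simp: oriented_paths_def\<close>)
  obtain r where q: "q = r @ [j]"
    using snoc.prems(2) append_butlast_last_id[of q] that[of "butlast q"]
    by (auto simp: oriented_paths_def)
  have x: "x = j"
    using snoc.prems(1) by (simp add: oriented_paths_def)
  show ?case
  proof (cases "p = [] \<or> r = []")
    case True
    then show ?thesis
      using split[of p] split[of r] snoc.prems no_loop unfolding q x by auto
  next
    case False
    then have p: "p \<in> oriented_paths \<Omega> i (last p)" "(last p, j) \<in> \<Omega>" "(i, last p) \<in> \<Omega>\<^sup>*"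
      and r: "r \<in> oriented_paths \<Omega> i (last r)" "(last r, j) \<in> \<Omega>" "(i, last r) \<in> \<Omega>\<^sup>*"
      using split[of p] split[of r] snoc.prems unfolding q x by auto
    have "last p = last r"
      using unique_in_edge[OF assms(1)] p r by blast
    then show ?thesis
      using snoc.IH[of "last p" r] p r by (simp add: q x)
  qed
qed

text \<open>Paths to \<open>i\<close> from \<open>k\<close> and from \<open>k'\<close>, each
  prolonged backwards to \<open>j\<close>, are equal by uniqueness, hence so are their second
  vertices.\<close>

lemma unique_out_edge:
  assumes "(j, k) \<in> \<Omega>" "(k, i) \<in> \<Omega>\<^sup>*" "(j, k') \<in> \<Omega>" "(k', i) \<in> \<Omega>\<^sup>*"
  shows "k = k'"
proof -
  obtain p p' where p: "p \<in> oriented_paths \<Omega> k i" "p' \<in> oriented_paths \<Omega> k' i"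
    using assms(2,4) by (auto simp: path_le_iff_rtrancl[symmetric] path_le_def)
  have "j \<in> I" using assms(1) edges_in by auto
  then have "j # p = j # p'"
    using oriented_path_unique oriented_paths_Cons p assms(1,3) by metis
  with p show ?thesis by (auto simp: oriented_paths_def)
qed

lemma card_oriented_paths:
  assumes "i \<in> I"
  shows "finite (oriented_paths \<Omega> i j)"
    and "card (oriented_paths \<Omega> i j) = (if path_le \<Omega> i j then 1 else 0)"
proof -
  consider "oriented_paths \<Omega> i j = {}" | p where "oriented_paths \<Omega> i j = {p}"
    using oriented_path_unique[OF assms] by blast
  then have "finite (oriented_paths \<Omega> i j) \<and>
      card (oriented_paths \<Omega> i j) = (if path_le \<Omega> i j then 1 else 0)"
    by cases (simp_all add: path_le_def)
  then show "finite (oriented_paths \<Omega> i j)"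
    and "card (oriented_paths \<Omega> i j) = (if path_le \<Omega> i j then 1 else 0)"
    by blast+
qed

abbreviation \<b> :: "'i \<Rightarrow> 'a" where
  "\<b> i \<equiv> (\<Sum>j | j \<in> I \<and> path_le \<Omega> j i. a j)"

text \<open>Pairing with \<open>a j\<close> counts 1 if \<open>j\<close> lies below
  \<open>i\<close>, minus the arrows out of \<open>j\<close> that stay below \<open>i\<close>. For
  \<open>j\<close> strictly below \<open>i\<close> there is exactly one such arrow, which cancels
  the 1; for \<open>j = i\<close> acyclicity leaves none; otherwise both terms vanish.\<close>

lemma E_dual:
  assumes ij: "i \<in> I" "j \<in> I"
  shows "E (\<b> i) (a j) = (if i = j then 1 else 0)"
proof -
  define S where "S = {k. k \<in> I \<and> path_le \<Omega> k i}"
  define Out where "Out = {k. (j, k) \<in> \<Omega> \<and> (k, i) \<in> \<Omega>\<^sup>*}"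
  have S: "finite S" "S \<subseteq> I" using finite_index by (auto simp: S_def)
  have Out: "Out \<subseteq> S"
    using edges_in by (auto simp: S_def Out_def path_le_iff_rtrancl)
  have "(j, j) \<notin> \<Omega>" using no_loop by blast
  then have val: "E (a k) (a j) = (if k = j then 1 else 0) - (if k \<in> Out then 1 else 0)"
    if "k \<in> S" for k
    using E_basis[of k j] ij that by (auto simp: S_def Out_def path_le_iff_rtrancl)
  have "E (\<b> i) (a j) = (\<Sum>k\<in>S. E (a k) (a j))"
    unfolding S_def by (rule bilinear_sum_left[OF bilinear_E])
  also have "\<dots> = (\<Sum>k\<in>S. (if k = j then 1 else 0) - (if k \<in> Out then 1 else 0))"
    using val by (intro sum.cong) auto
  also have "\<dots> = (if j \<in> S then 1 else 0) - (\<Sum>k\<in>S. if k \<in> Out then 1 else 0)"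
    using S by (simp add: sum_subtractf)
  also have "(\<Sum>k\<in>S. if k \<in> Out then 1 else (0::real)) = real (card (S \<inter> Out))"
    using S by (simp add: sum.inter_restrict[symmetric])
  also have "S \<inter> Out = Out" using Out by auto
  finally have E_eq: "E (\<b> i) (a j) = (if j \<in> S then 1 else 0) - real (card Out)" .
  \<comment> \<open>A nontrivial path from \<open>j\<close> to \<open>i\<close> starts with an arrow
    to a member of \<open>Out\<close>.\<close>
  have jS: "j \<in> S \<longleftrightarrow> i = j \<or> Out \<noteq> {}"
    using ij by (auto simp: S_def Out_def path_le_iff_rtrancl
        elim: converse_rtranclE intro: converse_rtrancl_into_rtrancl)
  show ?thesis
  proof (cases "Out = {}")
    case True
    then show ?thesis using E_eq jS by auto
  next
    case False
    then obtain k where k: "k \<in> Out" by auto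
    then have "Out = {k}"
      using unique_out_edge[of j k i] by (auto simp: Out_def)
    moreover have "i \<noteq> j"
      using k no_loop by (auto simp: Out_def)
    ultimately show ?thesis using E_eq jS by auto
  qed
qed

text \<open>By duality, pairing with \<open>\<b> i\<close> on the left reads off the coefficient of
  \<open>a i\<close>.\<close>

lemma E_b_b:
  assumes "i \<in> I"
  shows "E (\<b> i) (\<b> j) = (if path_le \<Omega> i j then 1 else 0)"
proof -
  have "E (\<b> i) (\<b> j) = (\<Sum>k | k \<in> I \<and> path_le \<Omega> k j. E (\<b> i) (a k))"
    by (rule bilinear_sum_right[OF bilinear_E])
  also have "\<dots> = (\<Sum>k | k \<in> I \<and> path_le \<Omega> k j. if i = k then 1 else 0)"
    using assms by (intro sum.cong refl E_dual) auto
  also have "\<dots> = (if path_le \<Omega> i j then 1 else 0)"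
    using finite_index assms by simp
  finally show ?thesis .
qed

text \<open>The passage from the vectors \<open>\<b> i\<close> to the basis \<open>a\<close> is unitriangular for \<open>\<Omega>\<close>.\<close>

lemma additive_eq_on_basis:
  fixes f g :: "'a \<Rightarrow> real"
  assumes f: "\<And>A. A \<subseteq> I \<Longrightarrow> f (sum a A) = (\<Sum>i\<in>A. f (a i))"
    and g: "\<And>A. A \<subseteq> I \<Longrightarrow> g (sum a A) = (\<Sum>i\<in>A. g (a i))"
    and eq: "\<And>i. i \<in> I \<Longrightarrow> f (\<b> i) = g (\<b> i)"
    and i: "i \<in> I"
  shows "f (a i) = g (a i)"
proof -
  \<comment> \<open>A finite acyclic relation has a well-founded strict path order, so the value at
    \<open>a i\<close> follows from that at \<open>\<b> i\<close> and those at strictly smaller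
    vertices.\<close>
  have "finite \<Omega>"
    using edges_in finite_index by (meson finite_SigmaI finite_subset)
  then have "wf (\<Omega>\<^sup>+)"
    using acyclic by (intro wf_trancl finite_acyclic_wf)
  then show ?thesis
    using i
  proof (induction i rule: wf_induct_rule)
    case (less i)
    define S where "S = {j. j \<in> I \<and> path_le \<Omega> j i}"
    have S: "finite S" "S \<subseteq> I" "i \<in> S"
      using finite_index less.prems by (auto simp: S_def path_le_iff_rtrancl)
    have IH: "f (a j) = g (a j)" if "j \<in> S - {i}" for j
      using that less.IH[of j] by (auto simp: S_def path_le_iff_rtrancl rtrancl_eq_or_trancl)
    have "f (a i) + (\<Sum>j\<in>S - {i}. f (a j)) = f (sum a S)"
      using f[OF S(2)] S by (simp add: sum.remove[of S i "\<lambda>j. f (a j)"])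
    also have "\<dots> = g (sum a S)"
      using eq[OF less.prems] by (simp add: S_def)
    also have "\<dots> = g (a i) + (\<Sum>j\<in>S - {i}. g (a j))"
      using g[OF S(2)] S by (simp add: sum.remove[of S i "\<lambda>j. g (a j)"])
    finally show ?case
      using IH by simp
  qed
qed

end

section \<open>Additive forms on a generated group\<close>

lemma group_closure_of_int_scaleR:
  fixes x :: "'a::real_vector"
  assumes "x \<in> group_closure S"
  shows "of_int n *\<^sub>R x \<in> group_closure S"
proof -
  have nat: "of_nat m *\<^sub>R x \<in> group_closure S" for m
    using assms by (induction m) (auto simp: scaleR_left_distrib intro: group_closure_add)
  show ?thesis
    using nat[of "nat n"] nat[of "nat (- n)"] by (cases "n \<ge> 0") auto
qed

lemma group_closure_sum_mem:
  "(\<And>i. i \<in> A \<Longrightarrow> f i \<in> group_closure S) \<Longrightarrow> sum f A \<in> group_closure S"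
  by (induction A rule: infinite_finite_induct) (auto intro: group_closure_add)

lemma group_closure_subset: "R \<subseteq> group_closure S \<Longrightarrow> group_closure R \<subseteq> group_closure S"
proof
  fix x assume "R \<subseteq> group_closure S" "x \<in> group_closure R"
  then show "x \<in> group_closure S"
    by (induction rule: group_closure.induct[OF \<open>x \<in> group_closure R\<close>])
      (auto intro: group_closure.diff)
qed

text \<open>Nothing is assumed about \<open>B\<close> outside the group, so the usual linear rules
  are derived with membership side conditions.\<close>

context
  fixes S :: "'a::ab_group_add set" and B :: "'a \<Rightarrow> 'a \<Rightarrow> real"
  assumes B: "lattice_bilinear (group_closure S) B"
begin

text \<open>The base rule of \<open>group_closure\<close> also admits 0, so base cases of inductions
  meet it.\<close>

lemma lattice_bilinear_zero:
  assumes "z \<in> group_closure S"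
  shows "B 0 z = 0" "B z 0 = 0"
  using B assms unfolding lattice_bilinear_def
  by (metis add_cancel_right_left add.right_neutral zero_in_group_closure)+

lemma lattice_bilinear_diff:
  assumes "x \<in> group_closure S" "y \<in> group_closure S" "z \<in> group_closure S"
  shows "B (x - y) z = B x z - B y z" "B z (x - y) = B z x - B z y"
proof -
  have "x - y \<in> group_closure S" using assms by (auto intro: group_closure.diff)
  then have "B (x - y + y) z = B (x - y) z + B y z" "B z (x - y + y) = B z (x - y) + B z y"
    using B assms unfolding lattice_bilinear_def by blast+
  then show "B (x - y) z = B x z - B y z" "B z (x - y) = B z x - B z y" by auto
qed

lemma lattice_bilinear_sum_left:
  assumes "\<And>i. i \<in> A \<Longrightarrow> f i \<in> group_closure S" "z \<in> group_closure S"
  shows "B (sum f A) z = (\<Sum>i\<in>A. B (f i) z)"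
  using assms(1)
proof (induction A rule: infinite_finite_induct)
  case (insert i A)
  then show ?case
    using B assms(2) group_closure_sum_mem[of A f S] by (simp add: lattice_bilinear_def)
qed (simp_all add: lattice_bilinear_zero assms(2))

text \<open>Agreement spreads one argument at a time: first the right one, with a generator on the
  left, then the left one.\<close>

lemma lattice_bilinear_eqI:
  assumes B': "lattice_bilinear (group_closure S) B'"
    and eq: "\<And>s t. s \<in> S \<Longrightarrow> t \<in> S \<Longrightarrow> B s t = B' s t"
    and xy: "x \<in> group_closure S" "y \<in> group_closure S"
  shows "B x y = B' x y"
proof -
  have Bs: "B s y = B' s y" if "s \<in> S" for s
    using xy(2)
  proof induction
    case (base t)
    with that eq show ?case
      by (auto simp: lattice_bilinear_zero Submission.lattice_bilinear_zero[OF B'] group_closure.base)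
  next
    case (diff t u)
    with that show ?case
      by (simp add: lattice_bilinear_diff Submission.lattice_bilinear_diff[OF B'] group_closure.base)
  qed
  show ?thesis
    using xy(1)
  proof induction
    case (base s)
    with Bs xy show ?case
      by (auto simp: lattice_bilinear_zero Submission.lattice_bilinear_zero[OF B'])
  next
    case (diff s t)
    with xy show ?case
      by (simp add: lattice_bilinear_diff Submission.lattice_bilinear_diff[OF B'])
  qed
qed

lemma lattice_bilinear_Ints:
  assumes int: "\<And>s t. s \<in> S \<Longrightarrow> t \<in> S \<Longrightarrow> B s t \<in> \<int>"
    and xy: "x \<in> group_closure S" "y \<in> group_closure S"
  shows "B x y \<in> \<int>"
proof -
  have Bs: "B s y \<in> \<int>" if "s \<in> S" for s
    using xy(2)
  proof induction
    case (base t)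
    with that int show ?case by (auto simp: lattice_bilinear_zero group_closure.base)
  next
    case (diff t u)
    with that show ?case by (simp add: lattice_bilinear_diff group_closure.base)
  qed
  show ?thesis
    using xy(1)
  proof induction
    case (base s)
    with Bs xy show ?case by (auto simp: lattice_bilinear_zero)
  next
    case (diff s t)
    with xy show ?case by (simp add: lattice_bilinear_diff)
  qed
qed

end

section \<open>Simple roots and the normalized inner product\<close>

lemma root_lattice_simple:
  assumes "simple_root_system R \<Delta>"
  shows "root_lattice R = group_closure \<Delta>"
proof
  have "R \<subseteq> group_closure \<Delta>"
  proof
    fix \<gamma> assume "\<gamma> \<in> R"
    then obtain c :: "'a \<Rightarrow> int" where "\<gamma> = (\<Sum>\<delta>\<in>\<Delta>. of_int (c \<delta>) *\<^sub>R \<delta>)"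
      using assms unfolding simple_root_system_def by blast
    then show "\<gamma> \<in> group_closure \<Delta>"
      by (auto intro!: group_closure_sum_mem group_closure_of_int_scaleR intro: group_closure.base)
  qed
  then show "root_lattice R \<subseteq> group_closure \<Delta>" by (rule group_closure_subset)
  have "\<Delta> \<subseteq> root_lattice R"
    using assms unfolding simple_root_system_def by (auto intro: group_closure.base)
  then show "group_closure \<Delta> \<subseteq> root_lattice R" by (rule group_closure_subset)
qed

lemma reflection_in_weyl_group: "\<alpha> \<in> R \<Longrightarrow> reflection \<alpha> \<in> weyl_group R"
  unfolding weyl_group_def by (rule image_eqI[of _ _ "[\<alpha>]"]) auto

text \<open>With \<open>c\<close> the coefficient on the right, invariance under the reflection in
  \<alpha>, which negates \<alpha>, gives \<open>- ip x \<alpha> + 2 * c = ip x \<alpha>\<close>.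
  This makes reflections of the ambient inner product reflections for \<open>ip\<close>.\<close>

lemma normalized_inner_product_root:
  assumes R: "root_system R" and ip: "normalized_inner_product R ip" and \<alpha>: "\<alpha> \<in> R"
  shows "ip x \<alpha> = 2 * (x \<bullet> \<alpha>) / (\<alpha> \<bullet> \<alpha>)"
proof -
  have bil: "bilinear ip" and self: "ip \<alpha> \<alpha> = 2"
    and inv: "ip (reflection \<alpha> x) (reflection \<alpha> \<alpha>) = ip x \<alpha>"
    using ip \<alpha> reflection_in_weyl_group[OF \<alpha>] by (auto simp: normalized_inner_product_def)
  have "\<alpha> \<noteq> 0" using R \<alpha> by (auto simp: root_system_def)
  then have "reflection \<alpha> \<alpha> = - \<alpha>"
    by (simp add: reflection_def scaleR_2)
  with inv self show ?thesis
    unfolding reflection_def[of _ x]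
    by (simp add: bilinear_rneg[OF bil] bilinear_lsub[OF bil] bilinear_lmul[OF bil])
qed

text \<open>The root \<open>reflection \<beta> \<alpha>\<close> is \<alpha> minus \<open>n\<close>
  times \<beta>, where the integer \<open>n\<close> is \<open>ip \<alpha> \<beta>\<close>. Its
  coefficient 1 at \<alpha> forces the one at \<beta> to be nonnegative, so
  \<open>n \<le> 0\<close>. Positivity at \<open>\<alpha> + \<beta>\<close> gives
  \<open>4 + 2 * n > 0\<close>.\<close>

lemma simple_roots_ip:
  assumes R: "root_system R" and ip: "normalized_inner_product R ip"
    and \<Delta>: "simple_root_system R \<Delta>" and ab: "\<alpha> \<in> \<Delta>" "\<beta> \<in> \<Delta>" "\<alpha> \<noteq> \<beta>"
  shows "ip \<alpha> \<beta> = 0 \<or> ip \<alpha> \<beta> = -1"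
proof -
  have bil: "bilinear ip" and sym: "\<And>x y. ip x y = ip y x"
    and pos: "\<And>x. x \<noteq> 0 \<Longrightarrow> ip x x > 0" and self: "\<And>\<gamma>. \<gamma> \<in> R \<Longrightarrow> ip \<gamma> \<gamma> = 2"
    using ip by (auto simp: normalized_inner_product_def)
  have sub: "\<Delta> \<subseteq> R" and ind: "independent \<Delta>"
    using \<Delta> by (auto simp: simple_root_system_def)
  have fin: "finite \<Delta>" using ind by (rule independent_imp_finite)
  have roots: "\<alpha> \<in> R" "\<beta> \<in> R" using sub ab by auto
  have "2 * (\<alpha> \<bullet> \<beta>) / (\<beta> \<bullet> \<beta>) \<in> \<int>"
    using R roots by (auto simp: root_system_def)
  then obtain n :: int where n: "ip \<alpha> \<beta> = of_int n"
    using normalized_inner_product_root[OF R ip roots(2)] by (auto elim: Ints_cases)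
  have r: "reflection \<beta> \<alpha> = \<alpha> - of_int n *\<^sub>R \<beta>"
    unfolding reflection_def normalized_inner_product_root[OF R ip roots(2), symmetric] n ..
  have "reflection \<beta> \<alpha> \<in> R"
    using R roots by (auto simp: root_system_def)
  then obtain c :: "'a \<Rightarrow> int" where c: "reflection \<beta> \<alpha> = (\<Sum>\<delta>\<in>\<Delta>. of_int (c \<delta>) *\<^sub>R \<delta>)"
    "(\<forall>\<delta>\<in>\<Delta>. c \<delta> \<ge> 0) \<or> (\<forall>\<delta>\<in>\<Delta>. c \<delta> \<le> 0)"
    using \<Delta> unfolding simple_root_system_def by blast
  interpret indexed_basis \<Delta> "\<lambda>\<delta>. \<delta>"
    using \<Delta> fin by unfold_locales (auto simp: simple_root_system_def)
  define d :: "'a \<Rightarrow> real" where "d \<delta> = (if \<delta> = \<alpha> then 1 else 0) - (if \<delta> = \<beta> then of_int n else 0)" for \<delta>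
  have "(\<Sum>\<delta>\<in>\<Delta>. d \<delta> *\<^sub>R \<delta>) = (\<Sum>\<delta>\<in>\<Delta>. (if \<delta> = \<alpha> then \<delta> else 0) - (if \<delta> = \<beta> then of_int n *\<^sub>R \<delta> else 0))"
    unfolding d_def by (intro sum.cong) (auto simp: scaleR_left_diff_distrib)
  also have "\<dots> = reflection \<beta> \<alpha>"
    using fin ab by (simp add: sum_subtractf r)
  finally have "of_int (c \<delta>) = d \<delta>" if "\<delta> \<in> \<Delta>" for \<delta>
    using c(1) sum_coeff_unique[of "\<lambda>\<delta>. of_int (c \<delta>)" d \<delta>] that by simp
  from this[OF ab(1)] this[OF ab(2)] have "of_int (c \<alpha>) = (1::real)" "of_int (c \<beta>) = (- of_int n :: real)"
    using ab(3) by (auto simp: d_def)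
  then have "c \<alpha> = 1" "c \<beta> = - n"
    by linarith+
  with c(2) ab have "n \<le> 0" by fastforce
  have "\<alpha> + \<beta> \<noteq> 0"
  proof
    assume "\<alpha> + \<beta> = 0"
    moreover have "(\<Sum>\<delta>\<in>\<Delta>. (if \<delta> = \<alpha> \<or> \<delta> = \<beta> then 1 else 0) *\<^sub>R \<delta>) =
        (\<Sum>\<delta>\<in>\<Delta>. (if \<delta> = \<alpha> then \<delta> else 0) + (if \<delta> = \<beta> then \<delta> else 0))"
      using ab(3) by (intro sum.cong) auto
    ultimately show False
      using sum_zero_coeff[of "\<lambda>\<delta>. if \<delta> = \<alpha> \<or> \<delta> = \<beta> then 1 else 0" \<alpha>] ab fin
      by (simp add: sum.distrib)
  qed
  then have "ip (\<alpha> + \<beta>) (\<alpha> + \<beta>) > 0" by (rule pos)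
  also have "ip (\<alpha> + \<beta>) (\<alpha> + \<beta>) = 4 + 2 * of_int n"
    using self[OF roots(1)] self[OF roots(2)] n sym[of \<beta> \<alpha>]
    by (simp add: bilinear_ladd[OF bil] bilinear_radd[OF bil])
  finally have "n > -2" by linarith
  with \<open>n \<le> 0\<close> have "n = 0 \<or> n = -1" by linarith
  with n show ?thesis by auto
qed

text \<open>Applied to a reversed Coxeter word, this keeps \<open>inv C x\<close> in the lattice,
  where a Coxeter form is determined.\<close>

lemma refl_prod_root_lattice:
  assumes R: "root_system R" and xs: "set xs \<subseteq> R" and x: "x \<in> root_lattice R"
  shows "refl_prod xs x \<in> root_lattice R"
proof -
  have refl: "reflection \<alpha> y \<in> root_lattice R" if "\<alpha> \<in> R" "y \<in> root_lattice R" for \<alpha> y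
    using that(2)
  proof induction
    case (base s)
    then show ?case
      using R that(1) linear_0[OF linear_reflection] by (auto simp: root_system_def intro: group_closure.base)
  next
    case (diff s t)
    then show ?case
      by (simp add: linear_diff[OF linear_reflection] group_closure.diff)
  qed
  show ?thesis
    using xs by (induction xs) (auto simp: x refl)
qed

section \<open>The form of a compatible simple root system\<close>

theorem theorem7p1:
  fixes R :: "'a::euclidean_space set"
    and I :: "'i set"
    and lab :: "'a set \<Rightarrow> 'i \<Rightarrow> 'a"
    and ip :: "'a \<Rightarrow> 'a \<Rightarrow> real"
    and C :: "'a \<Rightarrow> 'a"
    and \<Delta> :: "'a set"
  assumes "root_system R" "reduced_system R" "irreducible_system R" "simply_laced R"
    and "normalized_inner_product R ip"
    and "equivariant_labelling R I lab"
    and "coxeter_element R C"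
    and "simple_root_system R \<Delta>"
    and "coxeter_compatible I lab C \<Delta>"
  defines "\<Omega> \<equiv> coxeter_orientation I lab ip C \<Delta>"
    and "\<beta> \<equiv> \<beta>_root I lab ip C \<Delta>"
    and "Q \<equiv> root_lattice R"
  shows "(\<exists>B. is_coxeter_form R I lab ip C \<Delta> B) \<and>
    (\<forall>B B'. is_coxeter_form R I lab ip C \<Delta> B \<and> is_coxeter_form R I lab ip C \<Delta> B' \<longrightarrow>
       (\<forall>x\<in>Q. \<forall>y\<in>Q. B x y = B' x y)) \<and>
    (\<forall>B. is_coxeter_form R I lab ip C \<Delta> B \<longrightarrow>
       (\<forall>i\<in>I. \<forall>j\<in>I. B (\<beta> i) (\<beta> j) = (if path_le \<Omega> i j then 1 else 0)) \<and>
       (\<forall>i\<in>I. \<forall>j\<in>I. finite (oriented_paths \<Omega> i j) \<and>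
          B (\<beta> i) (\<beta> j) = real (card (oriented_paths \<Omega> i j))) \<and>
       (\<forall>x\<in>R. \<forall>y\<in>R. B x y \<in> \<int>) \<and>
       (\<forall>x\<in>Q. \<forall>y\<in>Q. B x y + B y x = ip x y) \<and>
       (\<forall>x\<in>Q. \<forall>y\<in>Q. B x y = - B y (inv C x)))"
proof -
  define a where "a = lab \<Delta>"
  have bij: "bij_betw a I \<Delta>"
    using assms unfolding equivariant_labelling_def a_def by blast
  then have a_img: "a ` I = \<Delta>" and a_inj: "inj_on a I" by (auto simp: bij_betw_def)
  have ind: "independent \<Delta>" and span_\<Delta>: "span \<Delta> = UNIV" and \<Delta>R: "\<Delta> \<subseteq> R"
    using assms(8) by (auto simp: simple_root_system_def)
  have fin: "finite I"
    using independent_imp_finite[OF ind] a_img a_inj by (metis finite_imageD)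
  note root_ip = normalized_inner_product_root[OF assms(1,5)]
  interpret simple_root_basis I a ip
  proof unfold_locales
    fix i x assume "i \<in> I"
    then have "a i \<in> R" using a_img \<Delta>R by auto
    then show "ip (a i) (a i) = 2" "reflection (a i) x = x - ip x (a i) *\<^sub>R a i"
      using assms(5) root_ip[of "a i" x] by (auto simp: normalized_inner_product_def reflection_def)
  qed (use assms(5) fin a_inj ind span_\<Delta> in \<open>auto simp: a_img normalized_inner_product_def\<close>)
  have ip_values: "ip (a i) (a j) = 0 \<or> ip (a i) (a j) = -1" if "i \<in> I" "j \<in> I" "i \<noteq> j" for i j
    using simple_roots_ip[OF assms(1,5,8), of "a i" "a j"] that a_img a_inj by (auto simp: inj_on_eq_iff)
  obtain xs where xs: "enumerates xs I" "C = refl_prod (map a xs)"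
    using assms(9) by (auto simp: coxeter_compatible_def coxeter_expression_def a_def)
  obtain E where E: "bilinear E" "\<And>x y. E x y + E y x = ip x y" "\<And>x y. E x y = - E y (inv C x)"
    and E_val: "\<And>ys k l. enumerates ys I \<Longrightarrow> C = refl_prod (map a ys) \<Longrightarrow> k \<in> I \<Longrightarrow> l \<in> I \<Longrightarrow>
      E (a k) (a l) = (if k = l then 1 else if precedes ys l k then ip (a l) (a k) else 0)"
    using euler_form_exists[OF xs] by blast
  \<comment> \<open>An arrow may come from any expression of \<open>C\<close>, but
    \<open>E_val\<close> covers all expressions with the same \<open>E\<close>. The converse can
    therefore use \<open>xs\<close> alone.\<close>
  have edge: "(l, k) \<in> \<Omega> \<longleftrightarrow> E (a k) (a l) = -1" if "k \<in> I" "l \<in> I" "k \<noteq> l" for k l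
  proof
    assume "(l, k) \<in> \<Omega>"
    then obtain ys where "enumerates ys I" "C = refl_prod (map a ys)" "precedes ys l k" "ip (a l) (a k) = -1"
      by (auto simp: \<Omega>_def coxeter_orientation_def coxeter_expression_def a_def)
    then show "E (a k) (a l) = -1"
      using E_val that by simp
  next
    assume "E (a k) (a l) = -1"
    then have "precedes xs l k" "ip (a l) (a k) = -1"
      using E_val[OF xs that(1,2)] that by (auto split: if_splits)
    then show "(l, k) \<in> \<Omega>"
      using xs that by (auto simp: \<Omega>_def coxeter_orientation_def coxeter_expression_def a_def)
  qed
  have edges: "\<Omega> \<subseteq> I \<times> I" "\<And>i. (i, i) \<notin> \<Omega>"
    by (auto simp: \<Omega>_def coxeter_orientation_def)
  \<comment> \<open>All arrows follow the order of the single word \<open>xs\<close>, which yields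
    acyclicity.\<close>
  have prec: "precedes xs i j" if "(i, j) \<in> \<Omega>" for i j
    using edge[of j i] E_val[OF xs, of j i] that edges by (fastforce split: if_splits)
  have "acyclic \<Omega>"
  proof -
    have "precedes xs i j" if "(i, j) \<in> \<Omega>\<^sup>+" for i j
      using that
    proof induction
      case (step j k)
      then show ?case using prec precedes_trans[of xs i j k] xs by (auto simp: enumerates_def)
    qed (rule prec)
    then show ?thesis
      using precedes_irrefl[of xs] xs by (auto simp: acyclic_def enumerates_def)
  qed
  \<comment> \<open>The symmetry relation on the diagonal says that \<open>E x x\<close> is half of
    \<open>ip x x\<close>.\<close>
  moreover have "E x x > 0" if "x \<noteq> 0" for x
    using E(2)[of x x] ip_pos[OF that] by simp
  \<comment> \<open>Distinct simple roots pair to 0 or -1, so a value of \<open>E\<close> that comes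
    from no arrow is 0.\<close>
  moreover have "E (a i) (a j) = (if i = j then 1 else if (j, i) \<in> \<Omega> then -1 else 0)"
    if "i \<in> I" "j \<in> I" for i j
    using edge[OF that] E_val[OF xs that] ip_values[OF that(2,1)] by (auto split: if_splits)
  ultimately interpret oriented_form I a \<Omega> E
    using E(1) edges by unfold_locales auto
  have \<beta>: "\<beta> i = \<b> i" for i
    by (simp add: \<beta>_def \<beta>_root_def \<Omega>_def a_def)
  have Q: "Q = group_closure (a ` I)"
    using root_lattice_simple[OF assms(8)] by (simp add: Q_def a_img)
  have aQ: "a i \<in> Q" if "i \<in> I" for i
    using that by (auto simp: Q intro: group_closure.base)
  have \<beta>Q: "\<beta> i \<in> Q" for i
    unfolding \<beta> using aQ by (auto simp: Q intro!: group_closure_sum_mem)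
  have E_lat: "lattice_bilinear (group_closure (a ` I)) E"
    by (simp add: lattice_bilinear_def bilinear_ladd[OF E(1)] bilinear_radd[OF E(1)])
  have form_iff: "is_coxeter_form R I lab ip C \<Delta> B \<longleftrightarrow> lattice_bilinear (group_closure (a ` I)) B \<and>
      (\<forall>i\<in>I. \<forall>j\<in>I. B (\<b> i) (a j) = (if i = j then 1 else 0))" for B
    unfolding is_coxeter_form_def \<beta>_def[symmetric] Q_def[symmetric] Q \<beta> a_def ..
  have E_form: "is_coxeter_form R I lab ip C \<Delta> E"
    using form_iff E_lat E_dual by blast
  \<comment> \<open>With \<open>a j\<close> on the right, duality fixes both forms on the
    \<open>\<b> i\<close>; triangularity carries the agreement to the \<open>a i\<close>, and
    additivity to all of \<open>Q\<close>. Uniqueness and the properties of \<open>B\<close> follow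
    from this.\<close>
  have B_eq_E: "B x y = E x y" if B: "is_coxeter_form R I lab ip C \<Delta> B" and xy: "x \<in> Q" "y \<in> Q" for B x y
  proof (rule lattice_bilinear_eqI[OF _ E_lat])
    show lat: "lattice_bilinear (group_closure (a ` I)) B" using B form_iff by blast
    fix s t assume "s \<in> a ` I" "t \<in> a ` I"
    then obtain i j where ij: "i \<in> I" "j \<in> I" "s = a i" "t = a j" by auto
    show "B s t = E s t"
      unfolding ij(3,4)
    proof (rule additive_eq_on_basis[OF _ _ _ ij(1)])
      fix A assume "A \<subseteq> I"
      then show "B (sum a A) (a j) = (\<Sum>i\<in>A. B (a i) (a j))"
        using aQ ij(2) by (intro lattice_bilinear_sum_left[OF lat]) (auto simp: Q)
      show "E (sum a A) (a j) = (\<Sum>i\<in>A. E (a i) (a j))"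
        by (rule bilinear_sum_left[OF E(1)])
    next
      fix i assume "i \<in> I"
      then show "B (\<b> i) (a j) = E (\<b> i) (a j)"
        using B form_iff E_dual ij(2) by simp
    qed
  qed (use xy Q in auto)
  have RQ: "x \<in> Q" if "x \<in> R" for x
    using that by (auto simp: Q_def intro: group_closure.base)
  \<comment> \<open>On simple roots \<open>E\<close> takes only the values 1, -1 and 0, and these
    roots generate \<open>Q\<close>.\<close>
  have E_int: "E x y \<in> \<int>" if "x \<in> Q" "y \<in> Q" for x y
    by (rule lattice_bilinear_Ints[OF E_lat]) (use that in \<open>auto simp: Q E_basis\<close>)
  have CQ: "inv C x \<in> Q" if "x \<in> Q" for x
    using refl_prod_root_lattice[OF assms(1), of "rev (map a xs)" x] that xs a_img \<Delta>R
    by (auto simp: inv_refl_prod enumerates_def Q_def)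
  have "(\<forall>i\<in>I. \<forall>j\<in>I. B (\<beta> i) (\<beta> j) = (if path_le \<Omega> i j then 1 else 0)) \<and>
       (\<forall>i\<in>I. \<forall>j\<in>I. finite (oriented_paths \<Omega> i j) \<and>
          B (\<beta> i) (\<beta> j) = real (card (oriented_paths \<Omega> i j))) \<and>
       (\<forall>x\<in>R. \<forall>y\<in>R. B x y \<in> \<int>) \<and>
       (\<forall>x\<in>Q. \<forall>y\<in>Q. B x y + B y x = ip x y) \<and>
       (\<forall>x\<in>Q. \<forall>y\<in>Q. B x y = - B y (inv C x))"
    if B: "is_coxeter_form R I lab ip C \<Delta> B" for B
  proof (intro conjI ballI)
    fix i j assume i: "i \<in> I"
    show B_\<beta>: "B (\<beta> i) (\<beta> j) = (if path_le \<Omega> i j then 1 else 0)"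
      using B_eq_E[OF B \<beta>Q \<beta>Q] E_b_b[OF i] by (simp add: \<beta>)
    show "finite (oriented_paths \<Omega> i j)" "B (\<beta> i) (\<beta> j) = real (card (oriented_paths \<Omega> i j))"
      using card_oriented_paths[OF i] B_\<beta> by simp_all
  next
    fix x y assume "x \<in> R" "y \<in> R"
    then show "B x y \<in> \<int>" using B_eq_E[OF B] E_int RQ by simp
  next
    fix x y assume "x \<in> Q" "y \<in> Q"
    then show "B x y + B y x = ip x y" "B x y = - B y (inv C x)"
      using B_eq_E[OF B] CQ E(2)[of x y] E(3)[of x y] by simp_all
  qed
  moreover have "B x y = B' x y"
    if "is_coxeter_form R I lab ip C \<Delta> B \<and> is_coxeter_form R I lab ip C \<Delta> B'" "x \<in> Q" "y \<in> Q"
    for B B' x y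
    using B_eq_E[of B x y] B_eq_E[of B' x y] that by simp
  ultimately show ?thesis
    using E_form by blast
qed

end
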